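(* Let $\sigma>0$ be a real number and, for $z\in\mathbb{C}$, let $$G(z)\equiv\int_{-\infty}^{\infty}w^{1-2z}e^{w^{2}}\,\mathrm{d}t,\qquad w=\sigma+it,$$ where the integration is over the real variable $t$. Then $$\frac{1}{\Gamma(z)}=\frac{1}{\pi}G(z)\qquad\text{for all } z\in\mathbb{C},$$ and $$\Gamma(z)\sin(\pi z)=G(1-z)\qquad\text{for all } z\in\mathbb{C},$$ where at $z\in\{0,-1,-2,\ldots\}$ the product $\Gamma(z)\sin(\pi z)$ is understood as its limiting value (removable singularity).
   Context: $\Gamma$ is the gamma function, defined by $\Gamma(z)=\int_0^\infty t^{z-1}e^{-t}\,\mathrm{d}t$ for $\operatorname{Re}(z)>0$ and extended to $\mathbb{C}\setminus\{0,-1,-2,\ldots\}$ by analytic continuation. Its reciprocal $1/\Gamma$ denotes the entire function, equal to $0$ at the poles $0,-1,-2,\ldots$ of $\Gamma$. Since $\operatorname{Re}(w)=\sigma>0$ on the path of integration, the power $w^{1-2z}=\exp((1-2z)\log w)$ is taken with the principal branch of the logarithm. *)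

theory Defs
  imports "HOL-Analysis.Analysis"
begin

definition G_integrand :: "real \<Rightarrow> complex \<Rightarrow> real \<Rightarrow> complex" where
  "G_integrand \<sigma> z t = (let w = Complex \<sigma> t in w powr (1 - 2 * z) * exp (w\<^sup>2))"

definition G :: "real \<Rightarrow> complex \<Rightarrow> complex" where
  "G \<sigma> z = (\<integral>t. G_integrand \<sigma> z t \<partial>lborel)"

(* The library's Gamma takes the value 0 at its poles, so there the product with the sine
   has to be replaced by its limit. *)
definition is_Gamma_sin_value :: "complex \<Rightarrow> complex \<Rightarrow> bool" where
  "is_Gamma_sin_value z v \<longleftrightarrow>
     (if z \<in> \<int>\<^sub>\<le>\<^sub>0
      then ((\<lambda>s. Gamma s * sin (complex_of_real pi * s)) \<longlongrightarrow> v) (at z)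
      else Gamma z * sin (complex_of_real pi * z) = v)"

end

theory Submission
  imports
    Defs
    "HOL-Probability.Characteristic_Functions"
    "HOL-Real_Asymp.Real_Asymp"
    "HOL-Complex_Analysis.Cauchy_Integral_Theorem"
begin

text \<open>
  Up to the factor \<open>1 / \<i>\<close>, the integral \<open>G \<sigma> z\<close> is the integral of \<open>w powr (1 - 2 * z) * exp (w\<^sup>2)\<close>
  along the vertical line \<open>Re w = \<sigma>\<close>; the substitution \<open>u = w\<^sup>2\<close> would turn it into Hankel's
  contour integral for \<open>1 / \<Gamma>\<close>. The proof below never deforms a contour.

  For \<open>Re z > 1/2\<close> put \<open>s = 2 * z - 1\<close>, so that \<open>Re s > 0\<close>. The power \<open>w powr - s\<close> is a Laplace
  transform, \<open>\<Gamma>(s) * w powr - s = \<integral>\<^sub>0\<^sup>\<infinity> x powr (s - 1) * exp (- x * w) dx\<close> (\<open>laplace_powr_eq\<close>). Inserting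
  this in \<open>G \<sigma> z\<close> and exchanging the integrals leaves, for each \<open>x\<close>, the Gaussian integral of
  \<open>exp (w\<^sup>2 - x * w) = exp ((w - x / 2)\<^sup>2) * exp (- x\<^sup>2 / 4)\<close>. Its value
  \<open>sqrt pi * exp (- x\<^sup>2 / 4)\<close> does not depend on the abscissa of the line
  (\<open>integral_exp_vertical_line\<close>), which is why \<open>\<sigma>\<close> disappears from the result. The remaining
  integral over \<open>x\<close> is \<open>2 powr (s - 1) * \<Gamma>(s / 2)\<close> (\<open>integral_mellin_gaussian\<close>), and Legendre's
  duplication formula gives \<open>G \<sigma> z = pi / \<Gamma>(z)\<close>.

  Integrating the derivative of \<open>w powr (- 2 * z) * exp (w\<^sup>2)\<close> over the whole line gives
  \<open>G \<sigma> z = z * G \<sigma> (z + 1)\<close> (\<open>G_plus1\<close>), which is also the recurrence of \<open>1 / \<Gamma>\<close>. It carries the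
  identity from \<open>Re z > 1/2\<close> to the whole plane in unit steps, which takes the place of
  analytic continuation. The formula for \<open>\<Gamma>(z) * sin (pi * z)\<close> is then the reflection formula; at a
  pole of \<open>\<Gamma>\<close> it survives as a limit, because the poles are isolated and \<open>1 / \<Gamma>\<close> is continuous.
\<close>

section \<open>Complex powers as Laplace transforms\<close>

definition laplace_kernel :: "complex \<Rightarrow> complex \<Rightarrow> real \<Rightarrow> complex" where
  "laplace_kernel s w x = of_real x powr (s - 1) * exp (- (of_real x * w))"

lemma laplace_kernel_measurable [measurable]: "laplace_kernel s w \<in> borel_measurable borel"
  unfolding laplace_kernel_def[abs_def] by measurable

lemma norm_laplace_kernel:
  "x > 0 \<Longrightarrow> norm (laplace_kernel s w x) = x powr (Re s - 1) * exp (- (x * Re w))"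
  by (simp add: laplace_kernel_def norm_mult norm_powr_real_powr)

text \<open>
  For real \<open>w\<close> this is the convergence of Euler's integral; as the norm of the kernel depends on
  \<open>w\<close> only through its real part, it dominates the complex case below.
\<close>

lemma set_integrable_powr_exp:
  assumes "Re s > 0" "a > 0"
  shows "set_integrable lborel {0<..} (laplace_kernel s (of_real a))"
proof -
  have "set_integrable lebesgue {0<..} (laplace_kernel s (of_real a))"
    using absolutely_integrable_Gamma_integral[OF assms]
    by (simp add: laplace_kernel_def[abs_def] exp_minus exp_of_real[symmetric] divide_inverse mult.commute)
  then show ?thesis
    unfolding set_integrable_def by (subst (asm) integrable_completion) auto
qed

lemma set_integrable_laplace_kernel:
  assumes "Re s > 0" "Re w > 0"
  shows "set_integrable lborel {0<..} (laplace_kernel s w)"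
  by (rule set_integrable_bound[OF set_integrable_powr_exp[OF assms]])
     (auto simp: norm_laplace_kernel set_borel_measurable_def)

definition laplace_powr :: "complex \<Rightarrow> complex \<Rightarrow> complex" where
  "laplace_powr s w = (LBINT x:{0<..}. laplace_kernel s w x)"

lemma laplace_powr_1:
  assumes "Re s > 0"
  shows "laplace_powr s 1 = Gamma s"
proof -
  have "laplace_powr s 1 = integral {0<..} (laplace_kernel s 1)"
    unfolding laplace_powr_def using assms
    by (intro set_borel_integral_eq_integral set_integrable_laplace_kernel) auto
  also have "\<dots> = Gamma s"
    using Gamma_integral_complex'[OF assms]
    by (intro integral_unique)
       (simp add: laplace_kernel_def[abs_def] exp_minus exp_of_real[symmetric] divide_inverse)
  finally show ?thesis .
qed

lemma norm_exp_second_order: "norm (exp z - 1 - z) \<le> exp (norm z) * norm z ^ 2" for z :: complex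
  using Taylor_exp_field[of z 1] by (simp add: power2_eq_square algebra_simps)

text \<open>
  Differentiation under the integral sign. The second-order Taylor remainder of \<open>exp (- x * h)\<close> is
  at most \<open>exp (x * norm h) * (x * norm h)\<^sup>2\<close>. As long as \<open>norm h < Re w / 2\<close>, half of the decay of
  \<open>exp (- x * w)\<close> absorbs the exponential factor, so the difference quotient is off by at most a
  constant times \<open>norm h\<close>; the factor \<open>x\<^sup>2\<close> raises the exponent of the dominating kernel by 2.
\<close>

lemma laplace_powr_has_field_derivative:
  assumes s: "Re s > 0" and w: "Re w > 0"
  shows "(laplace_powr s has_field_derivative - laplace_powr (s + 1) w) (at w)"
proof -
  define C where "C = (LBINT x:{0<..}. norm (laplace_kernel (s + 2) (of_real (Re w / 2)) x))"
  have quotient: "norm ((laplace_powr s (w + h) - laplace_powr s w) / h - - laplace_powr (s + 1) w) \<le> C * norm h"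
    if h: "h \<noteq> 0" "norm h < Re w / 2" for h
  proof -
    have wh: "Re (w + h) > 0"
      using abs_Re_le_cmod[of h] h w by auto
    let ?r = "\<lambda>x. laplace_kernel s (w + h) x - laplace_kernel s w x + h * laplace_kernel (s + 1) w x"
    have int: "set_integrable lborel {0<..} (laplace_kernel s (w + h))"
        "set_integrable lborel {0<..} (laplace_kernel s w)"
        "set_integrable lborel {0<..} (laplace_kernel (s + 1) w)"
        "set_integrable lborel {0<..} (laplace_kernel (s + 2) (of_real (Re w / 2)))"
      using s w wh by (auto intro!: set_integrable_laplace_kernel)
    have intr: "set_integrable lborel {0<..} ?r"
      using int by (intro set_integral_add set_integral_diff set_integrable_mult_right) auto
    have eq: "(LBINT x:{0<..}. ?r x) = laplace_powr s (w + h) - laplace_powr s w + h * laplace_powr (s + 1) w"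
      unfolding laplace_powr_def using int
      by (simp add: set_integral_add set_integral_diff set_integral_mult_right)
    have bound: "norm (?r x) \<le> norm h ^ 2 * norm (laplace_kernel (s + 2) (of_real (Re w / 2)) x)"
      if x: "x > 0" for x
    proof -
      have "?r x = laplace_kernel s w x * (exp (- (of_real x * h)) - 1 - (- (of_real x * h)))"
        using x by (simp add: laplace_kernel_def powr_diff algebra_simps exp_diff exp_minus exp_add field_simps)
      also have "norm \<dots> \<le> norm (laplace_kernel s w x) * (exp (x * norm h) * (x * norm h) ^ 2)"
        unfolding norm_mult
        using norm_exp_second_order[of "- (of_real x * h)"] x
        by (intro mult_left_mono) (auto simp: norm_mult)
      also have "\<dots> = norm h ^ 2 * (x powr (Re s + 1) * (exp (- (x * Re w)) * exp (x * norm h)))"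
        using x by (simp add: norm_laplace_kernel powr_diff powr_add power2_eq_square field_simps)
      also have "exp (- (x * Re w)) * exp (x * norm h) \<le> exp (- (x * (Re w / 2)))"
      proof -
        have "x * norm h \<le> x * (Re w / 2)" using h x by (intro mult_left_mono) auto
        then show ?thesis by (simp add: exp_add[symmetric] field_simps)
      qed
      finally show ?thesis using x by (simp add: norm_laplace_kernel mult_left_mono add.commute)
    qed
    have "norm (LBINT x:{0<..}. ?r x) \<le> (LBINT x:{0<..}. norm (?r x))"
      by (rule set_integral_norm_bound[OF intr])
    also have "\<dots> \<le> (LBINT x:{0<..}. norm h ^ 2 * norm (laplace_kernel (s + 2) (of_real (Re w / 2)) x))"
      using bound int intr by (intro set_integral_mono set_integrable_norm set_integrable_mult_right) auto
    also have "\<dots> = norm h ^ 2 * C" by (simp add: C_def)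
    finally have *: "norm (laplace_powr s (w + h) - laplace_powr s w + h * laplace_powr (s + 1) w) \<le> norm h ^ 2 * C"
      unfolding eq .
    have "(laplace_powr s (w + h) - laplace_powr s w) / h - - laplace_powr (s + 1) w
       = (laplace_powr s (w + h) - laplace_powr s w + h * laplace_powr (s + 1) w) / h"
      using h by (simp add: field_simps)
    also have "norm \<dots> \<le> norm h ^ 2 * C / norm h"
      unfolding norm_divide using * by (intro divide_right_mono) auto
    also have "\<dots> = C * norm h" using h by (simp add: power2_eq_square)
    finally show ?thesis .
  qed
  have "((\<lambda>h. (laplace_powr s (w + h) - laplace_powr s w) / h - - laplace_powr (s + 1) w) \<longlongrightarrow> 0) (at 0)"
  proof (rule Lim_null_comparison)
    show "\<forall>\<^sub>F h in at 0. norm ((laplace_powr s (w + h) - laplace_powr s w) / h - - laplace_powr (s + 1) w) \<le> C * norm h"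
      unfolding eventually_at using quotient w by (intro exI[of _ "Re w / 2"]) auto
    show "((\<lambda>h. C * norm h) \<longlongrightarrow> 0) (at 0)"
      by (auto intro!: tendsto_eq_intros)
  qed
  then show ?thesis
    unfolding DERIV_def by (rule LIM_zero_cancel)
qed

text \<open>
  Integration by parts: the derivative of \<open>x powr s * exp (- x * w)\<close> is a combination of the two
  kernels, and the boundary terms at 0 and at infinity vanish.
\<close>

lemma laplace_powr_plus1:
  assumes s: "Re s > 0" and w: "Re w > 0"
  shows "w * laplace_powr (s + 1) w = s * laplace_powr s w"
proof -
  define F where "F x = laplace_kernel (s + 1) w x" for x
  define f where "f x = s * laplace_kernel s w x - w * laplace_kernel (s + 1) w x" for x
  have int: "set_integrable lborel {0<..} (laplace_kernel s w)"
      "set_integrable lborel {0<..} (laplace_kernel (s + 1) w)"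
    using s w by (auto intro!: set_integrable_laplace_kernel)
  have "(LBINT x=0..\<infinity>. f x) = 0 - 0"
  proof (rule interval_integral_FTC_integrable[where F = F])
    fix x :: real assume "0 < ereal x"
    then have x: "x > 0" by simp
    show "(F has_vector_derivative f x) (at x)"
      unfolding F_def[abs_def] f_def laplace_kernel_def using x
      by (auto intro!: derivative_eq_intros has_vector_derivative_real_field simp: complex_nonpos_Reals_iff field_simps)
    show "isCont f x"
      unfolding f_def[abs_def] laplace_kernel_def using x
      by (auto intro!: continuous_intros simp: complex_nonpos_Reals_iff)
  next
    show "set_integrable lborel (einterval 0 \<infinity>) f"
      unfolding f_def[abs_def] zero_ereal_def einterval_eq using int
      by (intro set_integral_diff set_integrable_mult_right) auto
    have nF: "\<forall>\<^sub>F x in F'. norm (F x) \<le> x powr Re s * exp (- (x * Re w))" if "F' = at_top \<or> F' = at_right 0" for F'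
    proof -
      have "eventually (\<lambda>x. x > 0) F'"
        using that eventually_gt_at_top[of "0::real"] eventually_at_right_less[of "0::real"] by blast
      then show ?thesis
        by eventually_elim (simp add: F_def norm_laplace_kernel)
    qed
    have "(F \<longlongrightarrow> 0) (at_right 0)"
      by (rule Lim_null_comparison[OF nF]) (simp, use s w in real_asymp)
    then show "((F \<circ> real_of_ereal) \<longlongrightarrow> 0) (at_right 0)"
      unfolding zero_ereal_def ereal_tendsto_simps .
    have "(F \<longlongrightarrow> 0) at_top"
      by (rule Lim_null_comparison[OF nF]) (simp, use s w in real_asymp)
    then show "((F \<circ> real_of_ereal) \<longlongrightarrow> 0) (at_left \<infinity>)"
      unfolding ereal_tendsto_simps .
  qed auto
  then have "(LBINT x:{0<..}. f x) = 0"
    by (simp add: interval_lebesgue_integral_0_infty)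
  then show ?thesis
    unfolding f_def laplace_powr_def using int by simp
qed

text \<open>
  The two preceding lemmas say that the transform solves \<open>F'(w) = - (s / w) * F(w)\<close>, so that
  \<open>F(w) * w powr s\<close> is constant on the right half plane; at \<open>w = 1\<close> its value is \<open>\<Gamma>(s)\<close>.
\<close>

lemma laplace_powr_eq:
  assumes s: "Re s > 0" and w: "Re w > 0"
  shows "laplace_powr s w = Gamma s * w powr (-s)"
proof -
  have "((\<lambda>w. laplace_powr s w * w powr s) has_field_derivative 0) (at v within {v. Re v > 0})"
    if v: "v \<in> {v. Re v > 0}" for v
  proof -
    have v0: "v \<noteq> 0" "v \<notin> \<real>\<^sub>\<le>\<^sub>0" using v by (auto simp: complex_nonpos_Reals_iff)
    have "((\<lambda>w. laplace_powr s w * w powr s) has_field_derivative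
            - laplace_powr (s + 1) v * v powr s + s * v powr (s - 1) * laplace_powr s v) (at v)"
      using v v0 s by (intro DERIV_mult laplace_powr_has_field_derivative has_field_derivative_powr) auto
    moreover have "- laplace_powr (s + 1) v * v powr s + s * v powr (s - 1) * laplace_powr s v = 0"
      using laplace_powr_plus1[of s v] v v0 s by (simp add: powr_diff field_simps)
    ultimately show ?thesis by (simp add: has_field_derivative_at_within)
  qed
  from has_field_derivative_zero_constant[OF convex_halfspace_Re_gt this]
  obtain c where c: "\<And>v. Re v > 0 \<Longrightarrow> laplace_powr s v * v powr s = c" by auto
  have "laplace_powr s w * w powr s = Gamma s"
    using c[of w] c[of 1] w laplace_powr_1[OF s] by simp
  moreover have "w \<noteq> 0" using w by auto
  ultimately show ?thesis by (simp add: powr_minus field_simps)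
qed

section \<open>Gaussian integrals\<close>

lemma integrable_gaussian:
  assumes "a > 0"
  shows "integrable lborel (\<lambda>t::real. exp (- (a * t\<^sup>2)))"
proof -
  have "integrable lborel (\<lambda>t. sqrt (pi / a) * normal_density 0 (1 / sqrt (2 * a)) t)"
    using assms by (intro integrable_mult_right integrable_normal_density) auto
  also have "(\<lambda>t. sqrt (pi / a) * normal_density 0 (1 / sqrt (2 * a)) t) = (\<lambda>t. exp (- (a * t\<^sup>2)))"
    using assms by (auto simp: normal_density_def fun_eq_iff field_simps real_sqrt_divide)
  finally show ?thesis .
qed

lemma norm_exp_vertical_line: "norm (exp ((Complex c t)\<^sup>2)) = exp (c\<^sup>2) * exp (- t\<^sup>2)"
  by (simp add: power2_eq_square exp_add[symmetric] complex_eq_iff)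

text \<open>
  Writing \<open>(c + \<i> * t)\<^sup>2 = c\<^sup>2 - t\<^sup>2 + 2 * \<i> * c * t\<close> shows the integral to be \<open>exp (c\<^sup>2)\<close> times a Fourier
  transform of \<open>exp (- t\<^sup>2)\<close>. That transform is known as the characteristic function of the standard
  normal distribution, taken at \<open>sqrt 2 * c\<close>, and equals \<open>exp (- c\<^sup>2)\<close> up to normalisation.
\<close>

lemma integral_exp_vertical_line:
  "(\<integral>t. exp ((Complex c t)\<^sup>2) \<partial>lborel) = of_real (sqrt pi)"
proof -
  have "complex_of_real (exp (- c\<^sup>2)) = char std_normal_distribution (sqrt 2 * c)"
    by (simp add: char_std_normal_distribution power_mult_distrib)
  also have "\<dots> = (\<integral>x. std_normal_density x *\<^sub>R iexp (sqrt 2 * c * x) \<partial>lborel)"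
    unfolding char_def by (subst integral_density) auto
  \<comment> \<open>The scaling \<open>x = sqrt 2 * t\<close> turns \<open>exp (- x\<^sup>2 / 2)\<close> into \<open>exp (- t\<^sup>2)\<close>.\<close>
  also have "\<dots> = sqrt 2 *\<^sub>R (\<integral>t. std_normal_density (0 + sqrt 2 * t) *\<^sub>R iexp (sqrt 2 * c * (0 + sqrt 2 * t)) \<partial>lborel)"
    by (subst lborel_integral_real_affine[where c = "sqrt 2" and t = 0]) auto
  also have "(\<lambda>t. std_normal_density (0 + sqrt 2 * t) *\<^sub>R iexp (sqrt 2 * c * (0 + sqrt 2 * t)))
      = (\<lambda>t. of_real (exp (- c\<^sup>2) / sqrt (2 * pi)) * exp ((Complex c t)\<^sup>2))"
  proof
    fix t :: real
    have *: "(sqrt 2 * t)\<^sup>2 / 2 = t\<^sup>2" "sqrt 2 * c * (sqrt 2 * t) = 2 * c * t"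
      by (simp_all add: power_mult_distrib algebra_simps)
    have "std_normal_density (sqrt 2 * t) *\<^sub>R iexp (2 * c * t)
       = of_real (1 / sqrt (2 * pi)) * (exp (of_real (- t\<^sup>2)) * iexp (2 * c * t))"
      by (simp add: std_normal_density_def scaleR_conv_of_real * exp_of_real del: of_real_mult of_real_minus)
    also have "exp (of_real (- t\<^sup>2)) * iexp (2 * c * t) = exp (of_real (- c\<^sup>2)) * exp ((Complex c t)\<^sup>2)"
      by (simp add: exp_add[symmetric] Complex_eq power2_eq_square algebra_simps)
    finally show "std_normal_density (0 + sqrt 2 * t) *\<^sub>R iexp (sqrt 2 * c * (0 + sqrt 2 * t))
      = of_real (exp (- c\<^sup>2) / sqrt (2 * pi)) * exp ((Complex c t)\<^sup>2)"
      by (simp add: * exp_of_real[symmetric] del: of_real_mult)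
  qed
  finally have "of_real (exp (- c\<^sup>2)) = of_real (exp (- c\<^sup>2)) *
      (of_real (1 / sqrt pi) * (\<integral>t. exp ((Complex c t)\<^sup>2) \<partial>lborel))"
    by (simp add: scaleR_conv_of_real real_sqrt_mult)
  then have "of_real (1 / sqrt pi) * (\<integral>t. exp ((Complex c t)\<^sup>2) \<partial>lborel) = 1"
    unfolding mult_cancel_left1 by simp
  then have "of_real (sqrt pi) * (of_real (1 / sqrt pi) * (\<integral>t. exp ((Complex c t)\<^sup>2) \<partial>lborel)) = of_real (sqrt pi)"
    by simp
  moreover have "of_real (sqrt pi) * of_real (1 / sqrt pi) = (1 :: complex)"
    unfolding of_real_mult[symmetric] by simp
  ultimately show ?thesis by (simp only: mult.assoc[symmetric] mult_1_left)
qed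

text \<open>
  The elementary bound \<open>- x\<^sup>2 / 4 \<le> 1 - x\<close> reduces the Gaussian decay to that of Euler's integral.
\<close>

lemma set_integrable_mellin_gaussian:
  assumes "Re s > 0"
  shows "set_integrable lborel {0<..} (\<lambda>x. of_real x powr (s - 1) * exp (- (of_real x)\<^sup>2 / 4) :: complex)"
proof (rule set_integrable_bound)
  show "set_integrable lborel {0<..} (\<lambda>x. exp 1 * laplace_kernel s 1 x)"
    using assms by (intro set_integrable_mult_right set_integrable_laplace_kernel) auto
  have "norm (of_real x powr (s - 1) * exp (- (of_real x)\<^sup>2 / 4) :: complex) \<le> norm (exp 1 * laplace_kernel s 1 x)"
    if "x > 0" for x
  proof -
    have "0 \<le> (x / 2 - 1)\<^sup>2" by simp
    then have "exp (- x\<^sup>2 / 4) \<le> exp 1 * exp (- x)"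
      by (simp add: exp_add[symmetric] power2_eq_square algebra_simps)
    then show ?thesis using that
      by (simp add: norm_mult norm_laplace_kernel norm_powr_real_powr mult_left_mono algebra_simps)
  qed
  then show "AE x in lborel. x \<in> {0<..} \<longrightarrow>
      norm (of_real x powr (s - 1) * exp (- (of_real x)\<^sup>2 / 4) :: complex) \<le> norm (exp 1 * laplace_kernel s 1 x)"
    by auto
qed (auto simp: set_borel_measurable_def)

text \<open>
  The substitution \<open>u = x\<^sup>2 / 4\<close> in Euler's integral for \<open>\<Gamma>(s / 2)\<close>.
\<close>

lemma integral_mellin_gaussian:
  assumes s: "Re s > 0"
  shows "(LBINT x:{0<..}. of_real x powr (s - 1) * exp (- (of_real x)\<^sup>2 / 4) :: complex) = 2 powr (s - 1) * Gamma (s / 2)"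
proof -
  define f where "f = laplace_kernel (s / 2) 1"
  have pull_back: "(x / 2) *\<^sub>R f (x\<^sup>2 / 4)
      = 2 powr (1 - s) * (of_real x powr (s - 1) * exp (- (of_real x)\<^sup>2 / 4))" if x: "x > 0" for x
  proof -
    have ln4: "ln (x\<^sup>2 / 4) = 2 * (ln x - ln 2)"
      using x ln_realpow[of 2 2] by (simp add: ln_div ln_realpow)
    have "of_real (x\<^sup>2 / 4) powr (s / 2 - 1) = exp ((s / 2 - 1) * of_real (2 * (ln x - ln 2)))"
      using x by (subst ln4[symmetric], subst Ln_of_real[symmetric]) (simp_all add: powr_def)
    moreover have "complex_of_real (x / 2) = exp (of_real (ln x - ln 2))"
      using x by (simp add: exp_diff exp_of_real)
    moreover have "2 powr (1 - s) = exp ((1 - s) * of_real (ln 2))"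
      using Ln_of_real[of 2] by (simp add: powr_def)
    moreover have "of_real x powr (s - 1) = exp ((s - 1) * of_real (ln x))"
      using x by (simp add: powr_def Ln_of_real)
    ultimately show ?thesis
      by (simp add: f_def laplace_kernel_def scaleR_conv_of_real exp_add[symmetric] del: of_real_divide of_real_diff)
         (simp add: algebra_simps)
  qed
  have "(LBINT x=0..\<infinity>. f x) = (LBINT x=0..\<infinity>. (x / 2) *\<^sub>R f (x\<^sup>2 / 4))"
  proof (rule interval_integral_substitution_integrable)
    fix x :: real assume "0 < ereal x"
    then have x: "x > 0" by simp
    show "((\<lambda>x. x\<^sup>2 / 4) has_real_derivative x / 2) (at x)"
      by (auto intro!: derivative_eq_intros)
    show "isCont f (x\<^sup>2 / 4)"
      unfolding f_def laplace_kernel_def[abs_def] using x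
      by (auto intro!: continuous_intros simp: complex_nonpos_Reals_iff)
  next
    show "((ereal \<circ> (\<lambda>x. x\<^sup>2 / 4) \<circ> real_of_ereal) \<longlongrightarrow> 0) (at_right 0)"
      unfolding zero_ereal_def ereal_tendsto_simps by real_asymp
    show "((ereal \<circ> (\<lambda>x. x\<^sup>2 / 4) \<circ> real_of_ereal) \<longlongrightarrow> \<infinity>) (at_left \<infinity>)"
      unfolding ereal_tendsto_simps by real_asymp
    have "set_integrable lborel {0<..} (\<lambda>x. (x / 2) *\<^sub>R f (x\<^sup>2 / 4)) \<longleftrightarrow>
        set_integrable lborel {0<..} (\<lambda>x. 2 powr (1 - s) * (of_real x powr (s - 1) * exp (- (of_real x)\<^sup>2 / 4)))"
      by (intro set_integrable_cong) (auto simp: pull_back)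
    then show "set_integrable lborel (einterval 0 \<infinity>) (\<lambda>x. (x / 2) *\<^sub>R f (x\<^sup>2 / 4))"
      unfolding zero_ereal_def einterval_eq
      using set_integrable_mellin_gaussian[OF s] by (auto intro!: set_integrable_mult_right)
    show "set_integrable lborel (einterval 0 \<infinity>) f"
      unfolding zero_ereal_def einterval_eq f_def using s by (intro set_integrable_laplace_kernel) auto
  qed auto
  then have "Gamma (s / 2) = (LBINT x:{0<..}. (x / 2) *\<^sub>R f (x\<^sup>2 / 4))"
    using laplace_powr_1[of "s / 2"] s
    by (simp add: interval_lebesgue_integral_0_infty f_def laplace_powr_def)
  also have "\<dots> = (LBINT x:{0<..}. 2 powr (1 - s) * (of_real x powr (s - 1) * exp (- (of_real x)\<^sup>2 / 4)))"
    by (intro set_lebesgue_integral_cong) (auto simp: pull_back)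
  also have "\<dots> = 2 powr (1 - s) * (LBINT x:{0<..}. of_real x powr (s - 1) * exp (- (of_real x)\<^sup>2 / 4))"
    by simp
  finally have "2 powr (s - 1) * Gamma (s / 2) = (2 powr (s - 1) * 2 powr (1 - s)) *
      (LBINT x:{0<..}. of_real x powr (s - 1) * exp (- (of_real x)\<^sup>2 / 4))"
    by simp
  moreover have "2 powr (s - 1) * 2 powr (1 - s) = (1 :: complex)"
    by (simp add: powr_add[symmetric])
  ultimately show ?thesis by simp
qed

section \<open>The integral along a vertical line\<close>

text \<open>
  On the line, \<open>exp (w\<^sup>2)\<close> decays like \<open>exp (- t\<^sup>2)\<close>. The power \<open>w powr b\<close> grows at most like
  \<open>exp (\<bar>Re b\<bar> * norm w)\<close>, and by the inequality between the arithmetic and geometric means that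
  costs at most half of the decay. The constant must also cover small \<open>norm w\<close>, where a negative
  \<open>Re b\<close> makes the power large: this is where \<open>norm w \<ge> \<sigma> > 0\<close> enters, through \<open>ln \<sigma>\<close>.
\<close>

lemma powr_exp_square_bound:
  fixes b :: complex
  assumes \<sigma>: "\<sigma> > 0"
  obtains C where "\<And>t. norm (Complex \<sigma> t powr b * exp ((Complex \<sigma> t)\<^sup>2)) \<le> C * exp (- t\<^sup>2 / 2)"
proof
  fix t :: real
  define w where "w = Complex \<sigma> t"
  define \<beta> where "\<beta> = \<bar>Re b\<bar>"
  define \<gamma> where "\<gamma> = \<bar>Im b\<bar>"
  define L where "L = \<bar>ln \<sigma>\<bar>"
  define K where "K = \<gamma> * pi + \<beta> * L + \<beta>\<^sup>2 / 2 + 3 / 2 * \<sigma>\<^sup>2"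
  have w: "w \<noteq> 0" and r: "\<sigma> \<le> norm w" "(norm w)\<^sup>2 = \<sigma>\<^sup>2 + t\<^sup>2"
    using \<sigma> complex_Re_le_cmod[of w] by (auto simp: w_def complex_eq_iff cmod_def)
  have "\<bar>ln (norm w)\<bar> \<le> norm w + L"
    using ln_bound[of "norm w"] ln_mono[of \<sigma> "norm w"] r \<sigma> unfolding L_def by linarith
  then have "\<beta> * \<bar>ln (norm w)\<bar> \<le> \<beta> * (norm w + L)"
    by (intro mult_left_mono) (auto simp: \<beta>_def)
  then have "Re b * ln (norm w) \<le> \<beta> * (norm w + L)"
    using abs_ge_self[of "Re b * ln (norm w)"] unfolding \<beta>_def abs_mult by linarith
  moreover have "\<beta> * norm w \<le> \<beta>\<^sup>2 / 2 + (\<sigma>\<^sup>2 + t\<^sup>2) / 2"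
    using zero_le_power2[of "\<beta> - norm w"] unfolding r(2)[symmetric] by (simp add: power2_diff field_simps)
  moreover have "- Im b * Arg w \<le> \<gamma> * pi"
  proof -
    have "- Im b * Arg w \<le> \<gamma> * \<bar>Arg w\<bar>"
      using abs_ge_self[of "- Im b * Arg w"] by (simp add: abs_mult \<gamma>_def)
    also have "\<dots> \<le> \<gamma> * pi"
      using Arg_bounded[of w] by (intro mult_left_mono) (auto simp: \<gamma>_def)
    finally show ?thesis .
  qed
  ultimately have "Re b * ln (norm w) + - Im b * Arg w + (\<sigma>\<^sup>2 - t\<^sup>2) \<le> K + - t\<^sup>2 / 2"
    unfolding K_def distrib_left by (simp add: field_simps)
  moreover have "norm (w powr b * exp (w\<^sup>2)) = exp (Re b * ln (norm w) + - Im b * Arg w + (\<sigma>\<^sup>2 - t\<^sup>2))"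
  proof -
    have "norm (w powr b) = exp (Re b * ln (norm w) + - Im b * Arg w)"
      using w unfolding norm_powr_complex powr_def[of "norm w"] exp_add by simp
    moreover have "norm (exp (w\<^sup>2)) = exp (\<sigma>\<^sup>2 - t\<^sup>2)"
      unfolding w_def norm_exp_vertical_line by (simp add: exp_add[symmetric])
    ultimately show ?thesis
      unfolding norm_mult exp_add by simp
  qed
  ultimately show "norm (Complex \<sigma> t powr b * exp ((Complex \<sigma> t)\<^sup>2))
      \<le> exp (\<bar>Im b\<bar> * pi + \<bar>Re b\<bar> * \<bar>ln \<sigma>\<bar> + \<bar>Re b\<bar>\<^sup>2 / 2 + 3 / 2 * \<sigma>\<^sup>2) * exp (- t\<^sup>2 / 2)"
    by (simp add: w_def[symmetric] exp_add[symmetric] K_def \<beta>_def \<gamma>_def L_def)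
qed

lemma integrable_G_integrand:
  assumes "\<sigma> > 0"
  shows "integrable lborel (G_integrand \<sigma> z)"
proof -
  obtain C where C: "\<And>t. norm (Complex \<sigma> t powr (1 - 2 * z) * exp ((Complex \<sigma> t)\<^sup>2)) \<le> C * exp (- t\<^sup>2 / 2)"
    using powr_exp_square_bound[OF assms] by blast
  show ?thesis
  proof (rule Bochner_Integration.integrable_bound)
    show "integrable lborel (\<lambda>t. C * exp (- (1 / 2 * t\<^sup>2)))"
      by (intro integrable_mult_right integrable_gaussian) auto
    show "G_integrand \<sigma> z \<in> borel_measurable lborel"
      unfolding G_integrand_def[abs_def] Let_def Complex_eq by measurable
    show "AE t in lborel. norm (G_integrand \<sigma> z t) \<le> norm (C * exp (- (1 / 2 * t\<^sup>2)))"
      using C by (auto simp: G_integrand_def Let_def intro: order_trans[OF _ abs_ge_self])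
  qed
qed

text \<open>
  The derivative of \<open>w powr (- 2 * z) * exp (w\<^sup>2)\<close> along the line is a linear combination of the
  integrands for \<open>z\<close> and \<open>z + 1\<close>, and its integral vanishes because the function tends to 0 at both
  ends of the line.
\<close>

lemma G_plus1:
  assumes \<sigma>: "\<sigma> > 0"
  shows "G \<sigma> z = z * G \<sigma> (z + 1)"
proof -
  define F where "F t = Complex \<sigma> t powr (- 2 * z) * exp ((Complex \<sigma> t)\<^sup>2)" for t
  define f where "f t = 2 * \<i> * (G_integrand \<sigma> z t - z * G_integrand \<sigma> (z + 1) t)" for t
  obtain C where C: "\<And>t. norm (F t) \<le> C * exp (- t\<^sup>2 / 2)"
    unfolding F_def using powr_exp_square_bound[OF \<sigma>] by blast
  have int: "integrable lborel (G_integrand \<sigma> z)" "integrable lborel (G_integrand \<sigma> (z + 1))"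
    using \<sigma> by (auto intro: integrable_G_integrand)
  have "(LBINT t=-\<infinity>..\<infinity>. f t) = 0 - 0"
  proof (rule interval_integral_FTC_integrable[where F = F])
    fix t :: real
    define w where "w = of_real \<sigma> + \<i> * complex_of_real t"
    have w: "w \<notin> \<real>\<^sub>\<le>\<^sub>0" "w \<noteq> 0"
      using \<sigma> by (auto simp: w_def complex_nonpos_Reals_iff complex_eq_iff)
    have "((\<lambda>u. (of_real \<sigma> + \<i> * u) powr (- 2 * z) * exp ((of_real \<sigma> + \<i> * u)\<^sup>2)) has_field_derivative
        w powr (- 2 * z) * (exp (w\<^sup>2) * (2 * w * \<i>)) + (- 2 * z) * w powr (- 2 * z - 1) * \<i> * exp (w\<^sup>2)) (at (of_real t))"
      using w unfolding w_def
      by (auto intro!: derivative_eq_intros simp: algebra_simps)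
    moreover have "w powr (- 2 * z) * (exp (w\<^sup>2) * (2 * w * \<i>)) + (- 2 * z) * w powr (- 2 * z - 1) * \<i> * exp (w\<^sup>2) = f t"
    proof -
      have "w powr (1 - 2 * z) = w powr (- 2 * z) * w"
        using w powr_add[of w "- 2 * z" 1] by (simp add: add.commute)
      moreover have "w powr (1 - 2 * (z + 1)) = w powr (- 2 * z - 1)"
        by (rule arg_cong[where f = "\<lambda>a. w powr a"]) simp
      ultimately show ?thesis
        unfolding f_def G_integrand_def Let_def Complex_eq w_def[symmetric]
        by (simp only: ring_distribs ac_simps) (simp add: algebra_simps)
    qed
    ultimately show "(F has_vector_derivative f t) (at t)"
      unfolding F_def[abs_def] Complex_eq by (intro has_vector_derivative_real_field) simp
    have "isCont (G_integrand \<sigma> v) t" for v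
      unfolding G_integrand_def[abs_def] Let_def Complex_eq using w
      by (auto intro!: continuous_intros simp: w_def)
    then show "isCont f t"
      unfolding f_def[abs_def] by (intro continuous_intros)
  next
    show "set_integrable lborel (einterval (-\<infinity>) \<infinity>) f"
      using int by (simp add: set_integrable_def f_def[abs_def])
    have "(F \<longlongrightarrow> 0) at_bot"
      by (rule Lim_null_comparison[OF always_eventually[OF allI[OF C]]]) real_asymp
    then show "((F \<circ> real_of_ereal) \<longlongrightarrow> 0) (at_right (-\<infinity>))"
      unfolding ereal_tendsto_simps .
    have "(F \<longlongrightarrow> 0) at_top"
      by (rule Lim_null_comparison[OF always_eventually[OF allI[OF C]]]) real_asymp
    then show "((F \<circ> real_of_ereal) \<longlongrightarrow> 0) (at_left \<infinity>)"
      unfolding ereal_tendsto_simps .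
  qed auto
  then have "(\<integral>t. f t \<partial>lborel) = 0"
    by (simp add: interval_lebesgue_integral_le_eq set_lebesgue_integral_def)
  then show ?thesis
    unfolding f_def G_def using int by simp
qed

text \<open>
  The joint integrability required for the exchange of integrals is immediate, since the norm of
  the integrand is a product of a function of \<open>t\<close> and a function of \<open>x\<close>.
\<close>

lemma G_eq_right_half_plane:
  assumes \<sigma>: "\<sigma> > 0" and z: "Re z > 1 / 2"
  shows "G \<sigma> z = of_real pi * rGamma z"
proof -
  define s where "s = 2 * z - 1"
  have s: "Re s > 0" using z by (simp add: s_def)
  define f where "f t x = indicator {0<..} x *\<^sub>R (laplace_kernel s (Complex \<sigma> t) x * exp ((Complex \<sigma> t)\<^sup>2))" for t x
  have norm_f: "norm (f t x) = exp (\<sigma>\<^sup>2) * exp (- t\<^sup>2) * (indicator {0<..} x *\<^sub>R norm (laplace_kernel s (of_real \<sigma>) x))" for t x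
    by (auto simp: f_def indicator_def norm_mult norm_laplace_kernel norm_exp_vertical_line simp del: norm_exp_eq_Re)
  have int: "set_integrable lborel {0<..} (laplace_kernel s (Complex \<sigma> t))" for t
    using s \<sigma> by (intro set_integrable_laplace_kernel) auto
  have "integrable (lborel \<Otimes>\<^sub>M lborel) (\<lambda>(t, x). f t x)"
  proof (rule lborel_pair.Fubini_integrable)
    show "(\<lambda>(t, x). f t x) \<in> borel_measurable (lborel \<Otimes>\<^sub>M lborel)"
      unfolding f_def laplace_kernel_def Complex_eq by measurable
    show "integrable lborel (\<lambda>t. \<integral>x. norm (case (t, x) of (t, x) \<Rightarrow> f t x) \<partial>lborel)"
      using integrable_gaussian[of 1] by (simp add: norm_f)
    show "AE t in lborel. integrable lborel (\<lambda>x. case (t, x) of (t, x) \<Rightarrow> f t x)"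
      using int by (auto simp: f_def set_integrable_def mult_scaleR_left[symmetric] simp del: mult_scaleR_left)
  qed
  then have "(\<integral>x. (\<integral>t. f t x \<partial>lborel) \<partial>lborel) = (\<integral>t. (\<integral>x. f t x \<partial>lborel) \<partial>lborel)"
    by (rule lborel_pair.Fubini_integral)
  moreover have "(\<integral>x. f t x \<partial>lborel) = Gamma s * G_integrand \<sigma> z t" for t
  proof -
    have "(\<integral>x. f t x \<partial>lborel) = laplace_powr s (Complex \<sigma> t) * exp ((Complex \<sigma> t)\<^sup>2)"
      unfolding f_def laplace_powr_def set_lebesgue_integral_def mult_scaleR_left[symmetric]
      by (simp only: integral_mult_left_zero)
    also have "laplace_powr s (Complex \<sigma> t) = Gamma s * Complex \<sigma> t powr (1 - 2 * z)"
      using s \<sigma> by (subst laplace_powr_eq) (auto simp: s_def)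
    finally show ?thesis by (simp add: G_integrand_def Let_def)
  qed
  moreover have "(\<integral>t. f t x \<partial>lborel) = indicator {0<..} x *\<^sub>R
      (of_real (sqrt pi) * (of_real x powr (s - 1) * exp (- (of_real x)\<^sup>2 / 4)))" for x
  proof -
    \<comment> \<open>Completing the square moves the line to the abscissa \<open>\<sigma> - x / 2\<close>, of either sign.\<close>
    have "f t x = (indicator {0<..} x *\<^sub>R (of_real x powr (s - 1) * exp (- (of_real x)\<^sup>2 / 4))) * exp ((Complex (\<sigma> - x / 2) t)\<^sup>2)" for t
      by (simp add: f_def laplace_kernel_def exp_add[symmetric] Complex_eq power2_eq_square algebra_simps)
    then show ?thesis
      by (simp add: integral_exp_vertical_line)
  qed
  ultimately have "Gamma s * G \<sigma> z = (LBINT x:{0<..}. of_real (sqrt pi) * (of_real x powr (s - 1) * exp (- (of_real x)\<^sup>2 / 4)))"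
    unfolding G_def set_lebesgue_integral_def by simp
  also have "\<dots> = of_real (sqrt pi) * (2 powr (s - 1) * Gamma (s / 2))"
    unfolding set_integral_mult_right integral_mellin_gaussian[OF s] ..
  finally have *: "Gamma s * G \<sigma> z = of_real (sqrt pi) * (2 powr (s - 1) * Gamma (s / 2))" .
  have nz: "Gamma s \<noteq> 0" "Gamma z \<noteq> 0"
    using s z by (auto simp: Gamma_eq_zero_iff elim!: nonpos_Ints_cases)
  \<comment> \<open>Duplication at \<open>s / 2\<close> relates the two gamma values to \<open>\<Gamma>(z)\<close>, as \<open>s / 2 + 1 / 2 = z\<close>.\<close>
  have "Gamma (s / 2) * Gamma (s / 2 + 1 / 2) = exp ((1 - 2 * (s / 2)) * of_real (ln 2)) * of_real (sqrt pi) * Gamma (2 * (s / 2))"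
    using s by (intro Gamma_legendre_duplication) (auto elim!: nonpos_Ints_cases simp: complex_eq_iff)
  moreover have "s / 2 + 1 / 2 = z" by (simp add: s_def field_simps)
  moreover have "exp ((1 - 2 * (s / 2)) * of_real (ln 2)) = 2 powr (1 - s)"
    using Ln_of_real[of 2] by (simp add: powr_def)
  ultimately have "Gamma (s / 2) * Gamma z = 2 powr (1 - s) * of_real (sqrt pi) * Gamma s"
    by simp
  then have "Gamma s * (G \<sigma> z * Gamma z) = of_real (sqrt pi) * (2 powr (s - 1) * (2 powr (1 - s) * of_real (sqrt pi) * Gamma s))"
    using * by (metis mult.assoc)
  also have "\<dots> = (2 powr (s - 1) * 2 powr (1 - s)) * (of_real (sqrt pi) * of_real (sqrt pi)) * Gamma s"
    by (simp only: ac_simps)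
  also have "2 powr (s - 1) * 2 powr (1 - s) = (1 :: complex)"
    by (simp add: powr_add[symmetric])
  also have "of_real (sqrt pi) * of_real (sqrt pi) = complex_of_real pi"
    unfolding of_real_mult[symmetric] by simp
  finally have "G \<sigma> z * Gamma z = of_real pi"
    using nz by simp
  then show ?thesis
    using nz by (simp add: rGamma_inverse_Gamma field_simps)
qed

text \<open>
  Each use of the recurrence moves the boundary of the half plane one unit to the left.
\<close>

lemma G_eq_rGamma:
  assumes \<sigma>: "\<sigma> > 0"
  shows "G \<sigma> z = of_real pi * rGamma z"
proof -
  have "G \<sigma> z = of_real pi * rGamma z" if "Re z > 1 / 2 - real n" for n z
    using that
  proof (induction n arbitrary: z)
    case 0
    then show ?case using \<sigma> by (intro G_eq_right_half_plane) auto
  next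
    case (Suc n)
    then have "G \<sigma> (z + 1) = of_real pi * rGamma (z + 1)" by (intro Suc.IH) auto
    then show ?case
      using G_plus1[OF \<sigma>, of z] rGamma_plus1[of z] by (simp add: algebra_simps)
  qed
  moreover obtain n where "Re z > 1 / 2 - real n"
    using reals_Archimedean2[of "1 / 2 - Re z"] by (auto simp: algebra_simps)
  ultimately show ?thesis by blast
qed

section \<open>Reflection\<close>

text \<open>
  Off the poles this is the reflection formula divided by \<open>1 / \<Gamma>\<close>. The poles are isolated, so in a
  punctured neighbourhood of a pole the product agrees with the entire function \<open>pi / \<Gamma>(1 - s)\<close>, and
  its limit is the value of that function.
\<close>

lemma is_Gamma_sin_value_reflection: "is_Gamma_sin_value z (of_real pi * rGamma (1 - z))"
proof -
  have nonpole: "Gamma s * sin (of_real pi * s) = of_real pi * rGamma (1 - s)" if "s \<notin> \<int>\<^sub>\<le>\<^sub>0" for s :: complex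
  proof -
    have "sin (of_real pi * s) = of_real pi * (rGamma s * rGamma (1 - s))"
      by (simp add: rGamma_reflection_complex)
    then show ?thesis
      using that by (simp add: Gamma_def rGamma_eq_zero_iff)
  qed
  have "((\<lambda>s. Gamma s * sin (of_real pi * s)) \<longlongrightarrow> of_real pi * rGamma (1 - z)) (at z)"
  proof (rule Lim_transform_eventually)
    show "((\<lambda>s. of_real pi * rGamma (1 - s)) \<longlongrightarrow> of_real pi * rGamma (1 - z)) (at z)"
      by (intro isContD continuous_intros)
    have "closed (\<int>\<^sub>\<le>\<^sub>0 - {z})"
      by (rule closed_subset_Ints) (auto simp: nonpos_Ints_def)
    then have "eventually (\<lambda>s. s \<in> - (\<int>\<^sub>\<le>\<^sub>0 - {z}) - {z}) (at z)"
      by (intro eventually_at_in_open open_Compl) auto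
    then have "eventually (\<lambda>s. s \<notin> \<int>\<^sub>\<le>\<^sub>0) (at z)"
      by eventually_elim auto
    then show "\<forall>\<^sub>F s in at z. of_real pi * rGamma (1 - s) = Gamma s * sin (of_real pi * s)"
      by eventually_elim (simp add: nonpole)
  qed
  then show ?thesis
    using nonpole by (simp add: is_Gamma_sin_value_def)
qed

theorem theorem1:
  fixes \<sigma> :: real
  assumes "\<sigma> > 0"
  shows "(\<forall>z. integrable lborel (G_integrand \<sigma> z)) \<and>
         (\<forall>z. rGamma z = 1 / complex_of_real pi * G \<sigma> z) \<and>
         (\<forall>z. is_Gamma_sin_value z (G \<sigma> (1 - z)))"
  using assms by (simp add: integrable_G_integrand G_eq_rGamma is_Gamma_sin_value_reflection)

end
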